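(* Let $[a,b]\subset\mathbb{R}$. Suppose that $(R_m)$ and $(P_n)$ are two sequences of polynomials with integer coefficients, where $R_m$ has exact degree $m$, with $m\to\infty$ along the first sequence, and $P_n(x)=a_nx^n+\ldots$, $a_n\neq 0$, has exact degree $n$, with $n\to\infty$ along the second sequence. Assume that each $P_n$ has all its zeros in $[a,b]$, and that $P_n$ has no common zeros with $R_m$ whenever $n>m$. Then $$\limsup_{m\to\infty}\|R_m\|_{[a,b]}^{1/m}\;\liminf_{n\to\infty}|a_n|^{1/n}\ge 1.$$
   Context: Here $[a,b]$ is a nondegenerate segment ($a<b$), and $\|f\|_{[a,b]}:=\sup_{x\in[a,b]}|f(x)|$. Each sequence is indexed by the degrees of its members, which run through an infinite set of positive integers (the sets for the two sequences may differ); the $\limsup$ and $\liminf$ are taken along these sets. *)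

theory Defs
  imports "HOL-Library.Liminf_Limsup" "HOL-Library.Extended_Real"
    "HOL-Computational_Algebra.Polynomial"
begin

definition sup_norm_on :: "real \<Rightarrow> real \<Rightarrow> int poly \<Rightarrow> real" where
  "sup_norm_on a b p = (SUP x\<in>{a..b}. \<bar>poly (map_poly real_of_int p) x\<bar>)"

definition complex_zeros :: "int poly \<Rightarrow> complex set" where
  "complex_zeros p = {z. poly (map_poly of_int p) z = 0}"

text \<open>For an infinite set of degrees, this is the filter of passing to infinity along that
  set (on the full set of naturals it is \<^term>\<open>sequentially\<close>). For a finite set it is the
  trivial filter, so it should be used for infinite sets only.\<close>
definition along :: "nat set \<Rightarrow> nat filter" where
  "along S = inf sequentially (principal S)"

end

theory Submission
  imports Defs "HOL-Computational_Algebra.Fundamental_Theorem_Algebra"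
    "Jordan_Normal_Form.Determinant"
begin

text \<open>
  For \<open>m < n\<close>, the resultant of \<open>P\<^sub>n\<close> and \<open>R\<^sub>m\<close> is the product of \<open>a\<^sub>n\<^sup>m\<close> with the values
  of \<open>R\<^sub>m\<close> at the \<open>n\<close> zeros of \<open>P\<^sub>n\<close>. It is an integer, being a determinant in the
  coefficients, and it is nonzero since there is no common zero. As all the zeros of \<open>P\<^sub>n\<close> lie in
  \<open>[a,b]\<close>, its modulus is at most \<open>|a\<^sub>n|\<^sup>m\<close> times the \<open>n\<close>-th power of the sup norm of \<open>R\<^sub>m\<close>;
  so this bound is at least \<open>1\<close> (\<open>int_resultant_lower_bound\<close>). Taking \<open>mn\<close>-th roots gives
  \<open>|a\<^sub>n|\<^bsup>1/n\<^esup> r\<^sub>m \<ge> 1\<close>, where \<open>r\<^sub>m\<close> is the \<open>m\<close>-th root of the sup norm. Letting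
  \<open>n\<close> tend to infinity first and \<open>m\<close> afterwards yields the claim.

  The one delicate point is an infinite liminf, because \<open>0 * \<infinity> = 0\<close> for extended reals: the
  limsup then has to be positive. Indeed the sup norm on \<open>[a,b]\<close> of a nonzero integer
  polynomial of degree \<open>m\<close> is at least the \<open>m\<close>-th power of a positive constant (\<open>sup_norm_on_lower_bound\<close>), since its
  leading coefficient is at least \<open>1\<close> in modulus and equals an \<open>m\<close>-th finite difference of its
  values up to an explicit factor.

  The product formula for the resultant (\<open>det_sylvester_rows\<close>) holds over any integral domain and
  with multiplicities. It follows by writing one family of polynomials, the Newton polynomials of
  the zeros multiplied by \<open>R\<^sub>m\<close> or by \<open>a\<^sub>n\<close>, in two ways: through the rows of the Sylvester matrix
  and through the Newton polynomials themselves. Both changes of basis are triangular.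
\<close>

hide_const (open) Module.smult

section \<open>Coefficient matrices and Newton polynomials\<close>

definition coeff_mat :: "nat \<Rightarrow> (nat \<Rightarrow> 'a::zero poly) \<Rightarrow> 'a mat" where
  "coeff_mat d f = mat d d (\<lambda>(i, j). coeff (f i) j)"

lemma coeff_mat_carrier [simp]: "coeff_mat d f \<in> carrier_mat d d"
  by (simp add: coeff_mat_def)

text \<open>A change of polynomial families is a matrix factor; this turns all the determinant
  evaluations below into evaluations of triangular determinants.\<close>

lemma coeff_mat_linear_combination:
  fixes f g :: "nat \<Rightarrow> 'a::comm_ring_1 poly"
  assumes "\<And>i. i < d \<Longrightarrow> g i = (\<Sum>l<d. smult (c i l) (f l))"
  shows "coeff_mat d g = mat d d (\<lambda>(i, l). c i l) * coeff_mat d f"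
proof (rule eq_matI)
  fix i j
  assume "i < dim_row (mat d d (\<lambda>(i, l). c i l) * coeff_mat d f)"
    and "j < dim_col (mat d d (\<lambda>(i, l). c i l) * coeff_mat d f)"
  then have "i < d" "j < d" by (simp_all add: coeff_mat_def)
  then show "coeff_mat d g $$ (i, j) = (mat d d (\<lambda>(i, l). c i l) * coeff_mat d f) $$ (i, j)"
    by (simp add: coeff_mat_def scalar_prod_def assms coeff_sum atLeast0LessThan)
qed (simp_all add: coeff_mat_def)

lemma det_lower_triangular_mat:
  assumes "\<And>i j. i < j \<Longrightarrow> j < d \<Longrightarrow> c i j = 0"
  shows "det (mat d d (\<lambda>(i, j). c i j)) = (\<Prod>i<d. c i i :: 'a::comm_ring_1)"
  by (subst det_lower_triangular[of d])
    (auto simp: assms prod_list_diag_prod atLeast0LessThan)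

lemma det_upper_triangular_mat:
  assumes "\<And>i j. j < i \<Longrightarrow> i < d \<Longrightarrow> c i j = 0"
  shows "det (mat d d (\<lambda>(i, j). c i j)) = (\<Prod>i<d. c i i :: 'a::comm_ring_1)"
  by (subst det_upper_triangular[of _ d])
    (auto simp: assms prod_list_diag_prod atLeast0LessThan upper_triangular_def)

text \<open>The Newton interpolation basis for the nodes \<open>z 0, z 1, \<dots>\<close>; repeated nodes are allowed.\<close>

definition newton_poly :: "(nat \<Rightarrow> 'a::comm_ring_1) \<Rightarrow> nat \<Rightarrow> 'a poly" where
  "newton_poly z k = (\<Prod>i<k. [:- z i, 1:])"

lemma newton_poly_0 [simp]: "newton_poly z 0 = 1"
  by (simp add: newton_poly_def)

lemma newton_poly_Suc: "newton_poly z (Suc k) = newton_poly z k * [:- z k, 1:]"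
  by (simp add: newton_poly_def)

lemma degree_newton_poly: "degree (newton_poly z k) = (k::nat)"
  and lead_coeff_newton_poly: "coeff (newton_poly z k) k = (1 :: 'a::idom)"
proof -
  have "degree (newton_poly z k) = k \<and> lead_coeff (newton_poly z k) = 1"
  proof (induction k)
    case (Suc k)
    then have "newton_poly z k \<noteq> 0" by auto
    then have "degree (newton_poly z (Suc k)) = Suc k"
      using Suc.IH by (simp add: newton_poly_Suc degree_mult_eq del: mult_pCons_right)
    moreover have "lead_coeff (newton_poly z (Suc k)) = 1"
      using Suc.IH unfolding newton_poly_Suc lead_coeff_mult by auto
    ultimately show ?case by simp
  qed simp
  then show "degree (newton_poly z k) = k" "coeff (newton_poly z k) k = 1" by auto
qed

text \<open>Splitting off \<open>poly q (z k)\<close> leaves a multiple of \<open>[:- z k, 1:]\<close>, whose linear factor is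
  absorbed into the next Newton polynomial. Hence multiplication by \<open>q\<close> is triangular in the
  Newton basis, and the diagonal carries the values of \<open>q\<close> at the nodes.\<close>

lemma newton_expansion:
  fixes z :: "nat \<Rightarrow> 'a::comm_ring_1"
  assumes "degree q \<le> r"
  shows "\<exists>c. newton_poly z k * q = (\<Sum>l\<in>{k..k + r}. smult (c l) (newton_poly z l)) \<and>
    c k = poly q (z k)"
  using assms
proof (induction r arbitrary: k q)
  case 0
  then obtain a where "q = [:a:]" by (metis le_0_eq degree_eq_zeroE)
  then show ?case by (intro exI[of _ "\<lambda>_. a"]) simp
next
  case (Suc r)
  define q' where "q' = synthetic_div q (z k)"
  have "degree q' \<le> r" using Suc.prems by (simp add: q'_def degree_synthetic_div)
  from Suc.IH[OF this, of "Suc k"] obtain c where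
    c: "newton_poly z (Suc k) * q' = (\<Sum>l\<in>{Suc k..Suc k + r}. smult (c l) (newton_poly z l))"
    by blast
  have "newton_poly z k * q = newton_poly z k * ([:- z k, 1:] * q' + [:poly q (z k):])"
    unfolding q'_def by (subst synthetic_div_correct') simp
  also have "\<dots> = smult (poly q (z k)) (newton_poly z k) + newton_poly z (Suc k) * q'"
    by (simp add: newton_poly_Suc algebra_simps)
  also have "\<dots> = (\<Sum>l\<in>{k..k + Suc r}.
      smult ((c(k := poly q (z k))) l) (newton_poly z l))"
  proof -
    have "{k..k + Suc r} = insert k {Suc k..Suc k + r}" by auto
    then show ?thesis unfolding c by simp
  qed
  finally show ?case by (intro exI[of _ "c(k := poly q (z k))"]) simp
qed

section \<open>The resultant of a split polynomial\<close>

text \<open>The polynomials whose coefficients form the Sylvester matrix, for \<open>n\<close> the degree of \<open>p\<close>.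
  With the multiples of \<open>q\<close> first and exponents increasing, no sign appears in the
  product formula.\<close>

definition sylvester_rows :: "'a::comm_ring_1 poly \<Rightarrow> 'a poly \<Rightarrow> nat \<Rightarrow> nat \<Rightarrow> 'a poly" where
  "sylvester_rows p q n i = (if i < n then monom 1 i * q else monom 1 (i - n) * p)"

text \<open>Continuing the node sequence by zeros makes the Newton polynomials beyond \<open>n\<close> the
  monomial multiples of the \<open>n\<close>-th one, that is, up to a constant, the rows that stem from \<open>p\<close>.\<close>

lemma newton_poly_trailing_zeros:
  assumes "\<And>i. n \<le> i \<Longrightarrow> z i = 0" and "n \<le> i"
  shows "newton_poly z i = monom 1 (i - n) * newton_poly z n"
  using assms(2)
proof (induction i rule: dec_induct)
  case (step i)
  have "[:0, 1:] = (monom 1 1 :: 'a poly)" by (simp add: monom_Suc monom_0)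
  then show ?case
    using step assms(1)[of i]
    by (simp add: newton_poly_Suc mult_monom Suc_diff_le algebra_simps
        del: mult_pCons_right mult_pCons_left)
qed simp

text \<open>With \<open>e\<^sub>i\<close> for the Newton polynomials, let \<open>g\<^sub>i\<close> be \<open>e\<^sub>i q\<close> for \<open>i < n\<close> and
  \<open>a e\<^sub>i\<close> otherwise. Expanding the monic \<open>e\<^sub>i\<close> in monomials expresses the \<open>g\<^sub>i\<close> through the
  Sylvester rows by a lower unitriangular matrix. Expanding \<open>e\<^sub>i q\<close> in Newton polynomials expresses
  them through the \<open>e\<^sub>l\<close> by an upper triangular matrix with diagonal entries \<open>q(z\<^sub>i)\<close> and \<open>a\<close>.
  The coefficient matrix of the \<open>e\<^sub>l\<close> is lower unitriangular again.\<close>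

lemma det_sylvester_rows:
  fixes z :: "nat \<Rightarrow> 'a::idom"
  assumes z0: "\<And>i. n \<le> i \<Longrightarrow> z i = 0" and dq: "degree q \<le> m"
  shows "det (coeff_mat (n + m) (sylvester_rows (smult a (newton_poly z n)) q n))
    = a ^ m * (\<Prod>i<n. poly q (z i))"
proof -
  let ?d = "n + m"
  let ?f = "sylvester_rows (smult a (newton_poly z n)) q n"
  define g where "g i = (if i < n then newton_poly z i * q else smult a (newton_poly z i))" for i
  define A where "A i l = (if i < n then coeff (newton_poly z i) l else if i = l then 1 else 0)"
    for i l
  have gA: "g i = (\<Sum>l<?d. smult (A i l) (?f l))" if i: "i < ?d" for i
  proof (cases "i < n")
    case True
    have "newton_poly z i = (\<Sum>l\<le>i. monom (coeff (newton_poly z i) l) l)"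
      using poly_as_sum_of_monoms[of "newton_poly z i"] by (simp add: degree_newton_poly)
    then have "g i = (\<Sum>l\<le>i. monom (coeff (newton_poly z i) l) l) * q"
      using True by (simp add: g_def)
    also have "\<dots> = (\<Sum>l\<le>i. smult (A i l) (?f l))"
      using True by (auto simp: sum_distrib_right A_def sylvester_rows_def smult_monom
          simp flip: mult_smult_left intro!: sum.cong)
    also have "\<dots> = (\<Sum>l<?d. smult (A i l) (?f l))"
      using True by (intro sum.mono_neutral_left)
        (auto simp: A_def coeff_eq_0 degree_newton_poly)
    finally show ?thesis .
  next
    case False
    then have "(\<Sum>l<?d. smult (A i l) (?f l)) = (\<Sum>l<?d. if i = l then ?f l else 0)"
      by (intro sum.cong) (auto simp: A_def)
    also have "\<dots> = ?f i" using i by simp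
    also have "\<dots> = g i"
      using False newton_poly_trailing_zeros[of n z i] z0
      by (simp add: g_def sylvester_rows_def)
    finally show ?thesis by simp
  qed
  have "\<forall>i. \<exists>c. i < n \<longrightarrow> newton_poly z i * q = (\<Sum>l\<in>{i..i + m}. smult (c l) (newton_poly z l))
      \<and> c i = poly q (z i)"
    using newton_expansion[OF dq, of z] by blast
  then obtain c where c: "\<And>i. i < n \<Longrightarrow>
      newton_poly z i * q = (\<Sum>l\<in>{i..i + m}. smult (c i l) (newton_poly z l))"
    and cdiag: "\<And>i. i < n \<Longrightarrow> c i i = poly q (z i)"
    by metis
  define B where "B i l = (if i < n then (if l \<in> {i..i + m} then c i l else 0)
      else if i = l then a else 0)" for i l
  have gB: "g i = (\<Sum>l<?d. smult (B i l) (newton_poly z l))" if i: "i < ?d" for i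
  proof (cases "i < n")
    case True
    then have "g i = (\<Sum>l\<in>{i..i + m}. smult (B i l) (newton_poly z l))"
      by (simp add: g_def c B_def)
    also have "\<dots> = (\<Sum>l<?d. smult (B i l) (newton_poly z l))"
      using True by (intro sum.mono_neutral_left) (auto simp: B_def)
    finally show ?thesis .
  next
    case False
    then have "(\<Sum>l<?d. smult (B i l) (newton_poly z l))
        = (\<Sum>l<?d. if i = l then smult a (newton_poly z l) else 0)"
      by (intro sum.cong) (auto simp: B_def)
    then show ?thesis using i False by (simp add: g_def)
  qed
  have detA: "det (mat ?d ?d (\<lambda>(i, l). A i l)) = 1"
    by (subst det_lower_triangular_mat)
      (auto simp: A_def coeff_eq_0 degree_newton_poly lead_coeff_newton_poly intro!: prod.neutral)
  have "det (mat ?d ?d (\<lambda>(i, l). B i l)) = (\<Prod>i<?d. B i i)"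
    by (rule det_upper_triangular_mat) (auto simp: B_def)
  also have "\<dots> = (\<Prod>i<n. B i i) * (\<Prod>i\<in>{n..<?d}. B i i)"
    by (subst prod.union_disjoint[symmetric]) (auto intro!: prod.cong)
  also have "\<dots> = a ^ m * (\<Prod>i<n. poly q (z i))"
    by (simp add: B_def cdiag)
  finally have detB: "det (mat ?d ?d (\<lambda>(i, l). B i l)) = a ^ m * (\<Prod>i<n. poly q (z i))" .
  have detN: "det (coeff_mat ?d (newton_poly z)) = 1"
    unfolding coeff_mat_def
    by (subst det_lower_triangular_mat)
      (auto simp: coeff_eq_0 degree_newton_poly lead_coeff_newton_poly)
  have "coeff_mat ?d g = mat ?d ?d (\<lambda>(i, l). A i l) * coeff_mat ?d ?f"
    by (rule coeff_mat_linear_combination) (rule gA)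
  then have "det (coeff_mat ?d ?f) = det (coeff_mat ?d g)"
    by (simp add: det_mult[of _ ?d] detA)
  moreover have "coeff_mat ?d g = mat ?d ?d (\<lambda>(i, l). B i l) * coeff_mat ?d (newton_poly z)"
    by (rule coeff_mat_linear_combination) (rule gB)
  then have "det (coeff_mat ?d g) = a ^ m * (\<Prod>i<n. poly q (z i))"
    by (simp add: det_mult[of _ ?d] detB detN)
  ultimately show ?thesis by simp
qed

text \<open>The fundamental theorem of algebra, with the zeros listed with multiplicity and
  continued by \<open>0\<close>.\<close>

lemma split_complex_poly:
  fixes p :: "complex poly"
  assumes "p \<noteq> 0"
  obtains z where "p = smult (lead_coeff p) (newton_poly z (degree p))"
    and "\<And>i. i < degree p \<Longrightarrow> poly p (z i) = 0" and "\<And>i. degree p \<le> i \<Longrightarrow> z i = 0"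
proof -
  obtain A where A: "size A = degree p" "p = smult (lead_coeff p) (\<Prod>x\<in>#A. [:- x, 1:])"
    using alg_closed_imp_factorization[OF assms] by blast
  obtain xs where xs: "mset xs = A" using ex_mset by blast
  have len: "length xs = degree p" using A(1) xs by (metis size_mset)
  define z where "z i = (if i < degree p then xs ! i else 0)" for i
  have "(\<Prod>x\<in>#A. [:- x, 1:]) = prod_list (map (\<lambda>x. [:- x, 1:]) xs)"
    by (simp add: xs[symmetric] prod_mset_prod_list flip: mset_map)
  also have "\<dots> = newton_poly z (degree p)"
    by (simp add: prod.list_conv_set_nth len newton_poly_def z_def atLeast0LessThan)
  finally have p: "p = smult (lead_coeff p) (newton_poly z (degree p))" using A(2) by simp
  moreover have "poly p (z i) = 0" if "i < degree p" for i
    by (subst p) (use that in \<open>auto simp: newton_poly_def poly_prod\<close>)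
  ultimately show ?thesis using that by (simp add: z_def)
qed

lemma map_mat_coeff_mat_sylvester_rows:
  "map_mat of_int (coeff_mat d (sylvester_rows p q n))
    = coeff_mat d (sylvester_rows (map_poly of_int p) (map_poly of_int q :: 'a::{comm_ring_1,ring_char_0} poly) n)"
  by (rule eq_matI) (simp_all add: coeff_mat_def sylvester_rows_def coeff_map_poly coeff_monom_mult)

text \<open>The bound \<open>K\<close> dominates each factor \<open>q(z)\<close> of the resultant, which is a nonzero integer.\<close>

lemma int_resultant_lower_bound:
  fixes p q :: "int poly"
  assumes "p \<noteq> 0" and "complex_zeros p \<inter> complex_zeros q = {}"
    and bound: "\<And>w. w \<in> complex_zeros p \<Longrightarrow> norm (poly (map_poly of_int q) w) \<le> K"
  shows "1 \<le> \<bar>real_of_int (lead_coeff p)\<bar> ^ degree q * K ^ degree p"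
proof -
  let ?p = "map_poly of_int p :: complex poly" and ?q = "map_poly of_int q :: complex poly"
  let ?n = "degree p" and ?m = "degree q"
  have deg: "degree ?p = ?n" and lc: "coeff ?p ?n = of_int (lead_coeff p)"
    by (simp_all add: degree_map_poly coeff_map_poly)
  have "?p \<noteq> 0" using assms(1) by (simp add: map_poly_eq_0_iff)
  then obtain z where z: "?p = smult (of_int (lead_coeff p)) (newton_poly z ?n)"
    "\<And>i. i < ?n \<Longrightarrow> poly ?p (z i) = 0" "\<And>i. ?n \<le> i \<Longrightarrow> z i = 0"
    using split_complex_poly[of ?p] unfolding deg lc by metis
  define D where "D = det (coeff_mat (?n + ?m) (sylvester_rows p q ?n))"
  have "of_int D = det (coeff_mat (?n + ?m) (sylvester_rows ?p ?q ?n))"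
    unfolding D_def by (simp flip: map_mat_coeff_mat_sylvester_rows of_int_hom.hom_det)
  also have "\<dots> = of_int (lead_coeff p) ^ ?m * (\<Prod>i<?n. poly ?q (z i))"
    by (subst z(1), rule det_sylvester_rows) (auto simp: z(3) degree_map_poly)
  finally have D: "of_int D = of_int (lead_coeff p) ^ ?m * (\<Prod>i<?n. poly ?q (z i))" .
  have zero: "z i \<in> complex_zeros p" if "i < ?n" for i
    using z(2)[OF that] by (simp add: complex_zeros_def)
  have "poly ?q (z i) \<noteq> 0" if "i < ?n" for i
    using zero[OF that] assms(2) by (auto simp: complex_zeros_def)
  then have "of_int D \<noteq> (0::complex)"
    unfolding D using assms(1) by simp
  then have "1 \<le> \<bar>D\<bar>" by simp
  then have "1 \<le> \<bar>real_of_int D\<bar>" by linarith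
  also have "\<dots> = norm (of_int D :: complex)" by (simp add: norm_of_int)
  also have "\<dots> = \<bar>real_of_int (lead_coeff p)\<bar> ^ ?m * (\<Prod>i<?n. norm (poly ?q (z i)))"
    unfolding D by (simp add: norm_mult norm_power prod_norm)
  also have "\<dots> \<le> \<bar>real_of_int (lead_coeff p)\<bar> ^ ?m * (\<Prod>i<?n. K)"
    by (intro mult_left_mono prod_mono) (auto intro: bound zero)
  finally show ?thesis by simp
qed

section \<open>A lower bound for the sup norm\<close>

text \<open>A forward difference acts on the leading term like \<open>h\<close> times the derivative.\<close>

lemma degree_pcompose_shift_diff:
  fixes p :: "real poly"
  assumes "degree p \<le> Suc n"
  shows "degree (pcompose p [:h, 1:] - p) \<le> n"
    and "coeff (pcompose p [:h, 1:] - p) n = real (Suc n) * h * coeff p (Suc n)"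
proof -
  have "degree (pcompose p [:h, 1:] - p) \<le> n \<and>
    coeff (pcompose p [:h, 1:] - p) n = real (Suc n) * h * coeff p (Suc n)"
    using assms
  proof (induction n arbitrary: p)
    case 0
    then have "p = [:coeff p 0, coeff p 1:]"
      by (intro poly_eqI) (auto simp: coeff_pCons coeff_eq_0 split: nat.splits)
    then obtain a b where "p = [:a, b:]" by blast
    then show ?case by (simp add: pcompose_pCons)
  next
    case (Suc n)
    obtain a r where p: "p = pCons a r" by (metis pCons_cases)
    have r: "degree r \<le> Suc n" using Suc.prems p by (auto split: if_splits)
    let ?D = "pcompose r [:h, 1:] - r"
    have eq: "pcompose p [:h, 1:] - p = pCons 0 ?D + smult h (?D + r)"
      by (simp add: p pcompose_pCons algebra_simps)
    note IH = Suc.IH[OF r]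
    have "degree (pcompose p [:h, 1:] - p) \<le> Suc n"
      unfolding eq using IH r
      by (intro degree_add_le order.trans[OF degree_smult_le])
        (auto simp: degree_pCons_eq_if intro!: degree_add_le)
    moreover have "coeff ?D (Suc n) = 0" using IH by (intro coeff_eq_0) linarith
    then have "coeff (pcompose p [:h, 1:] - p) (Suc n)
        = real (Suc (Suc n)) * h * coeff p (Suc (Suc n))"
      unfolding eq using IH by (simp add: p algebra_simps)
    ultimately show ?case by blast
  qed
  then show "degree (pcompose p [:h, 1:] - p) \<le> n"
    and "coeff (pcompose p [:h, 1:] - p) n = real (Suc n) * h * coeff p (Suc n)" by auto
qed

text \<open>Each of \<open>n\<close> successive forward differences at most doubles the bound on the remaining sample
  points, and the \<open>n\<close>-th one is the constant \<open>n! h\<^sup>n\<close> times the top coefficient.\<close>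

lemma top_coeff_le_equispaced_bound:
  fixes p :: "real poly"
  assumes "degree p \<le> n" and "0 \<le> h" and "\<And>k. k \<le> n \<Longrightarrow> \<bar>poly p (x + real k * h)\<bar> \<le> B"
  shows "\<bar>coeff p n\<bar> * fact n * h ^ n \<le> 2 ^ n * B"
  using assms
proof (induction n arbitrary: p B)
  case 0
  then obtain a where "p = [:a:]" by (metis le_0_eq degree_eq_zeroE)
  then show ?case using 0(3)[of 0] by simp
next
  case (Suc n)
  let ?q = "pcompose p [:h, 1:] - p"
  note q = degree_pcompose_shift_diff[OF Suc.prems(1), of h]
  have "\<bar>poly ?q (x + real k * h)\<bar> \<le> 2 * B" if "k \<le> n" for k
  proof -
    have "poly ?q (x + real k * h) = poly p (x + real (Suc k) * h) - poly p (x + real k * h)"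
      by (simp add: poly_pcompose algebra_simps)
    then show ?thesis using Suc.prems(3)[of k] Suc.prems(3)[of "Suc k"] that by linarith
  qed
  from Suc.IH[OF q(1) Suc.prems(2) this]
  have "\<bar>coeff ?q n\<bar> * fact n * h ^ n \<le> 2 ^ n * (2 * B)" .
  moreover have "\<bar>coeff ?q n\<bar> = real (Suc n) * h * \<bar>coeff p (Suc n)\<bar>"
    unfolding q(2) using Suc.prems(2) by (simp add: abs_mult)
  ultimately show ?case by (simp add: algebra_simps)
qed

text \<open>The left-hand side over \<open>n!\<close> is a single term of the exponential series.\<close>

lemma power_self_le_exp_fact: "real n ^ n \<le> exp (real n) * fact n"
proof -
  have "(\<Sum>k\<in>{n}. real n ^ k /\<^sub>R fact k) \<le> (\<Sum>k. real n ^ k /\<^sub>R fact k)"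
    by (intro sum_le_suminf summable_exp_generic) auto
  then show ?thesis by (simp add: exp_def field_simps)
qed

lemma abs_poly_le_sup_norm_on:
  assumes "x \<in> {a..b}"
  shows "\<bar>poly (map_poly real_of_int p) x\<bar> \<le> sup_norm_on a b p"
proof -
  have "\<exists>x\<in>{a..b}. \<forall>y\<in>{a..b}.
      \<bar>poly (map_poly real_of_int p) y\<bar> \<le> \<bar>poly (map_poly real_of_int p) x\<bar>"
    using assms by (intro continuous_attains_sup continuous_intros) auto
  then have "bdd_above ((\<lambda>x. \<bar>poly (map_poly real_of_int p) x\<bar>) ` {a..b})"
    by (auto simp: bdd_above_def)
  then show ?thesis unfolding sup_norm_on_def using assms by (rule cSUP_upper[rotated])
qed

text \<open>The points \<open>a + kh\<close> with \<open>h = (b - a) / n\<close> fill the segment, so \<open>n! h\<^sup>n\<close> is at most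
  \<open>2\<^sup>n\<close> times the norm; and \<open>n!\<close> is at least \<open>(n / e)\<^sup>n\<close>. The constant is not the sharp
  \<open>(b - a) / 4\<close> of Chebyshev, but any positive one makes the limsup positive.\<close>

lemma sup_norm_on_lower_bound:
  assumes "a < b" and "p \<noteq> 0"
  shows "((b - a) / (2 * exp 1)) ^ degree p \<le> sup_norm_on a b p"
proof (cases "degree p = 0")
  case True
  then obtain c where "p = [:c:]" by (metis degree_eq_zeroE)
  with assms(2) have "1 \<le> \<bar>poly (map_poly real_of_int p) a\<bar>"
    by (simp add: map_poly_pCons)
  also have "\<dots> \<le> sup_norm_on a b p" using assms(1) by (intro abs_poly_le_sup_norm_on) auto
  finally show ?thesis using True by simp
next
  case False
  let ?n = "degree p" and ?B = "sup_norm_on a b p"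
  define h where "h = (b - a) / real ?n"
  have h: "0 \<le> h" "real ?n * h = b - a" using False assms(1) by (simp_all add: h_def)
  have "a + real k * h \<in> {a..b}" if "k \<le> ?n" for k
    using mult_right_mono[of "real k" "real ?n" h] that h by auto
  then have "\<bar>coeff (map_poly real_of_int p) ?n\<bar> * fact ?n * h ^ ?n \<le> 2 ^ ?n * ?B"
    using h(1) by (intro top_coeff_le_equispaced_bound[where x = a] abs_poly_le_sup_norm_on)
      (auto simp: degree_map_poly)
  moreover have "1 \<le> \<bar>lead_coeff p\<bar>"
    using assms(2) leading_coeff_0_iff[of p] by linarith
  then have "1 \<le> \<bar>coeff (map_poly real_of_int p) ?n\<bar>"
    by (simp add: coeff_map_poly)
  then have "1 * (fact ?n * h ^ ?n) \<le> \<bar>coeff (map_poly real_of_int p) ?n\<bar> * (fact ?n * h ^ ?n)"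
    using h(1) by (intro mult_right_mono) auto
  ultimately have 1: "fact ?n * h ^ ?n \<le> 2 ^ ?n * ?B"
    unfolding mult.assoc mult_1 by linarith
  have "(b - a) ^ ?n = real ?n ^ ?n * h ^ ?n" by (simp add: h(2) flip: power_mult_distrib)
  also have "\<dots> \<le> exp (real ?n) * (fact ?n * h ^ ?n)"
    using mult_right_mono[OF power_self_le_exp_fact[of ?n], of "h ^ ?n"] h(1)
    by (simp add: mult.assoc)
  also have "\<dots> \<le> exp (real ?n) * (2 ^ ?n * ?B)" using 1 by simp
  also have "\<dots> = (2 * exp 1) ^ ?n * ?B"
    by (simp add: power_mult_distrib mult.commute mult.left_commute flip: exp_of_nat_mult)
  finally show ?thesis by (simp add: power_divide field_simps)
qed

section \<open>Passage to the limit\<close>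

lemma along_neq_bot:
  assumes "infinite S"
  shows "along S \<noteq> bot"
proof
  assume "along S = bot"
  then have "eventually (\<lambda>x. x \<notin> S) sequentially"
    unfolding along_def trivial_limit_def eventually_inf_principal by simp
  then show False
    using assms unfolding eventually_sequentially infinite_nat_iff_unbounded_le by blast
qed

lemma eventually_along:
  assumes "\<And>x. x \<in> S \<Longrightarrow> m < x \<Longrightarrow> P x"
  shows "eventually P (along S)"
  unfolding along_def eventually_inf_principal
  using eventually_gt_at_top[of m] by eventually_elim (use assms in blast)

lemma one_le_root_product:
  fixes u v :: real
  assumes "0 < u" "0 < v" "0 < m" "0 < n" and "1 \<le> u ^ m * v ^ n"
  shows "1 \<le> u powr (1 / real n) * v powr (1 / real m)"
proof -
  have "0 \<le> ln (u ^ m * v ^ n)" using assms(5) by simp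
  also have "\<dots> = real m * ln u + real n * ln v"
    using assms by (simp add: ln_mult ln_realpow)
  finally have "0 \<le> (real m * ln u + real n * ln v) / (real m * real n)"
    using assms by (intro divide_nonneg_pos) auto
  also have "\<dots> = ln u / real n + ln v / real m" using assms by (simp add: field_simps)
  finally show ?thesis using assms by (simp add: powr_def flip: exp_add)
qed

theorem proposition1p1:
  fixes a b :: real
    and M N :: "nat set"
    and R P :: "nat \<Rightarrow> int poly"
  assumes "a < b"
    and "infinite M" and "0 \<notin> M"
    and "infinite N" and "0 \<notin> N"
    and "\<And>m. m \<in> M \<Longrightarrow> degree (R m) = m"
    and "\<And>n. n \<in> N \<Longrightarrow> degree (P n) = n"
    and "\<And>n. n \<in> N \<Longrightarrow> complex_zeros (P n) \<subseteq> complex_of_real ` {a..b}"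
    and "\<And>m n. m \<in> M \<Longrightarrow> n \<in> N \<Longrightarrow> m < n \<Longrightarrow> complex_zeros (P n) \<inter> complex_zeros (R m) = {}"
  shows "Limsup (along M) (\<lambda>m. ereal (sup_norm_on a b (R m) powr (1 / real m)))
       * Liminf (along N) (\<lambda>n. ereal (\<bar>real_of_int (lead_coeff (P n))\<bar> powr (1 / real n))) \<ge> 1"
proof -
  define r where "r m = sup_norm_on a b (R m) powr (1 / real m)" for m
  define s where "s n = \<bar>real_of_int (lead_coeff (P n))\<bar> powr (1 / real n)" for n
  define S where "S = Limsup (along M) (\<lambda>m. ereal (r m))"
  define L where "L = Liminf (along N) (\<lambda>n. ereal (s n))"
  define \<kappa> where "\<kappa> = (b - a) / (2 * exp 1)"
  have \<kappa>: "0 < \<kappa>" using assms(1) by (simp add: \<kappa>_def)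
  have M_pos: "0 < m" and R_nz: "R m \<noteq> 0" if "m \<in> M" for m
    using that assms(3) assms(6)[OF that] by (auto intro: Nat.gr0I)
  have N_pos: "0 < n" and P_nz: "P n \<noteq> 0" if "n \<in> N" for n
    using that assms(5) assms(7)[OF that] by (auto intro: Nat.gr0I)
  have norm_ge: "\<kappa> ^ m \<le> sup_norm_on a b (R m)" if "m \<in> M" for m
    using sup_norm_on_lower_bound[OF assms(1) R_nz[OF that]] assms(6)[OF that]
    by (simp add: \<kappa>_def)
  have r_ge: "\<kappa> \<le> r m" if "m \<in> M" for m
  proof -
    have "\<kappa> = (\<kappa> ^ m) powr (1 / real m)"
      using \<kappa> M_pos[OF that] by (subst powr_realpow[symmetric]) (simp_all add: powr_powr)
    also have "\<dots> \<le> r m"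
      unfolding r_def using norm_ge[OF that] \<kappa> by (intro powr_mono2) auto
    finally show ?thesis .
  qed
  have product: "1 \<le> s n * r m" if "m \<in> M" "n \<in> N" "m < n" for m n
  proof -
    have "norm (poly (map_poly of_int (R m)) w) \<le> sup_norm_on a b (R m)"
      if w: "w \<in> complex_zeros (P n)" for w
    proof -
      obtain x where x: "x \<in> {a..b}" "w = of_real x" using assms(8)[OF \<open>n \<in> N\<close>] w by blast
      have "poly (map_poly of_int (R m)) w = of_real (poly (map_poly real_of_int (R m)) x)"
        by (simp add: x(2) poly_altdef degree_map_poly coeff_map_poly)
      then show ?thesis using abs_poly_le_sup_norm_on[OF x(1)] by simp
    qed
    from int_resultant_lower_bound[OF P_nz[OF that(2)] assms(9)[OF that] this]
    have "1 \<le> \<bar>real_of_int (lead_coeff (P n))\<bar> ^ m * sup_norm_on a b (R m) ^ n"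
      by (simp add: assms(6)[OF that(1)] assms(7)[OF that(2)])
    moreover have "0 < sup_norm_on a b (R m)"
      using norm_ge[OF that(1)] \<kappa> by (meson less_le_trans zero_less_power)
    ultimately show ?thesis unfolding r_def s_def
      using P_nz[OF that(2)] M_pos[OF that(1)] N_pos[OF that(2)]
      by (intro one_le_root_product) auto
  qed
  have L_ge: "ereal (1 / r m) \<le> L" if "m \<in> M" for m
    unfolding L_def
  proof (intro Liminf_bounded eventually_along[of _ m])
    fix n assume "n \<in> N" "m < n"
    then show "ereal (1 / r m) \<le> ereal (s n)"
      using product[OF that] r_ge[OF that] \<kappa> by (simp add: field_simps)
  qed
  have S_ge: "c \<le> S" if "\<And>m. m \<in> M \<Longrightarrow> c \<le> ereal (r m)" for c
    unfolding S_def by (intro le_Limsup along_neq_bot assms(2) eventually_along[of _ 0] that)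
  \<comment> \<open>A finite \<open>L\<close> is at least \<open>1 / r m\<close> for every single \<open>m\<close>, which bounds every \<open>r m\<close> from below by
    \<open>1 / L\<close>; an infinite \<open>L\<close> only needs \<open>S\<close> to be positive, which \<open>\<kappa>\<close> guarantees.\<close>
  have "1 \<le> S * L"
  proof (cases L)
    case PInf
    have "0 < S" using S_ge[of "ereal \<kappa>"] r_ge \<kappa> by (auto intro: less_le_trans[of 0 "ereal \<kappa>"])
    then show ?thesis by (simp add: PInf)
  next
    case (real l)
    obtain m where m: "m \<in> M" using assms(2) by fastforce
    have "0 < 1 / r m" using r_ge[OF m] \<kappa> by simp
    also have "\<dots> \<le> l" using L_ge[OF m] real by simp
    finally have l: "0 < l" .
    have "ereal (1 / l) \<le> S"
    proof (rule S_ge)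
      fix m assume m: "m \<in> M"
      show "ereal (1 / l) \<le> ereal (r m)"
        using L_ge[OF m] real l r_ge[OF m] \<kappa> by (simp add: field_simps)
    qed
    then have "ereal (1 / l) * ereal l \<le> S * ereal l"
      using l by (intro ereal_mult_right_mono) auto
    then show ?thesis using real l by (simp add: one_ereal_def)
  next
    case MInf
    obtain m where "m \<in> M" using assms(2) by fastforce
    then show ?thesis using L_ge MInf by fastforce
  qed
  then show ?thesis by (simp add: S_def L_def r_def s_def)
qed

end
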